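(* Let $A \subseteq \{1,3,5,\ldots\}$ and $B \subseteq \{2,4,6,\ldots\}$ with $1 \in A$, and suppose that the smallest element of $\{1,2,3,\ldots\}\setminus(A\cup B)$ is $2m$ (with $m\ge 1$ an integer). If the power series (about $0$) of $$\frac{1}{1+ \sum_{k=1}^{2m-1} \frac{(-1)^k x^{k}}{k!} + \sum_{k=m+1}^{\infty} \frac{x^{2k}}{(2k)!}}$$ has all coefficients non-negative, then the power series of $$\frac{1}{1-\sum_{a \in A} \frac{x^a}{a!} + \sum_{b \in B} \frac{x^b}{b!}}$$ has all coefficients non-negative.
   Context: All series are formal power series in $x$; $A$ and $B$ may be finite or infinite. *)

theory Defs
  imports Complex_Main "HOL-Computational_Algebra.Formal_Power_Series"
begin

text \<open>The series \<open>\<Sum>n\<in>S. x^n / n!\<close>, for a finite or infinite set \<open>S\<close> of exponents,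
  given by its coefficients; \<open>exp_gf_sums\<close> confirms that it is the limit of the series
  in the topology of formal power series.\<close>

definition exp_gf :: "nat set \<Rightarrow> real fps" where
  "exp_gf S = Abs_fps (\<lambda>n. if n \<in> S then 1 / fact n else 0)"

lemma exp_gf_sums:
  "(\<lambda>n. if n \<in> S then fps_const (1 / fact n) * fps_X ^ n else 0) sums exp_gf S"
proof -
  let ?c = "\<lambda>n. if n \<in> S then 1 / fact n else (0::real)"
  have "(\<lambda>n. \<Sum>i=0..n. fps_const (?c i) * fps_X ^ i) \<longlonglongrightarrow> Abs_fps ?c"
    using fps_notation[of "Abs_fps ?c"] by simp
  moreover have "fps_const (?c i) * fps_X ^ i =
      (if i \<in> S then fps_const (1 / fact i) * fps_X ^ i else 0)" for i
    by simp
  ultimately show ?thesis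
    by (simp add: sums_def_le exp_gf_def atMost_atLeast0)
qed

end

(* Passing from the extremal denominator D of the hypothesis to the general one subtracts a
   series P with non-negative coefficients and no constant term: the exponents below 2m are
   forced, D has no other odd exponents and every even exponent above 2m.  Then
   1/(D - P) = (1/D) / (1 - Q) with Q = P/D non-negative, and R = 1/(1 - Q) is non-negative by the
   recursion R = 1 + R Q. *)
theory Submission
  imports Defs
begin

lemma fps_nth_mult_nonneg:
  fixes f g :: "'a::linordered_field fps"
  assumes "\<And>i. fps_nth f i \<ge> 0" "\<And>i. fps_nth g i \<ge> 0"
  shows "fps_nth (f * g) n \<ge> 0"
  by (simp add: fps_mult_nth assms sum_nonneg)

lemma fps_nth_inverse_one_minus_nonneg:
  fixes q :: "'a::linordered_field fps"
  assumes "fps_nth q 0 = 0" "\<And>i. fps_nth q i \<ge> 0"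
  shows "fps_nth (inverse (1 - q)) n \<ge> 0"
proof (induction n rule: less_induct)
  case (less n)
  let ?r = "inverse (1 - q)"
  have "?r * (1 - q) = 1"
    using assms(1) by (intro inverse_mult_eq_1) simp
  then have "?r = 1 + ?r * q"
    by (simp only: right_diff_distrib mult_1_right diff_eq_eq)
  then have "fps_nth ?r n = fps_nth (1 + ?r * q) n"
    by (rule arg_cong)
  also have "\<dots> = fps_nth 1 n + (\<Sum>i=0..n. fps_nth ?r i * fps_nth q (n - i))"
    by (simp add: fps_mult_nth)
  also have "\<dots> \<ge> 0"
  proof (intro add_nonneg_nonneg sum_nonneg)
    fix i assume "i \<in> {0..n}"
    \<comment> \<open>The term \<open>i = n\<close> vanishes because \<open>q\<close> has no
      constant term, so the recursion only calls on earlier coefficients of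
      \<open>?r\<close>.\<close>
    then show "fps_nth ?r i * fps_nth q (n - i) \<ge> 0"
      using less assms by (cases "i = n") auto
  qed simp
  finally show ?case .
qed

text \<open>Comparison principle: lowering non-constant coefficients of a denominator keeps its
  reciprocal non-negative.\<close>

lemma fps_nth_inverse_diff_nonneg:
  fixes d p :: "'a::linordered_field fps"
  assumes "fps_nth d 0 \<noteq> 0" "\<And>i. fps_nth (inverse d) i \<ge> 0"
    and "fps_nth p 0 = 0" "\<And>i. fps_nth p i \<ge> 0"
  shows "fps_nth (inverse (d - p)) n \<ge> 0"
proof -
  let ?q = "p * inverse d"
  have "d * inverse d = 1"
    using assms(1) by (rule inverse_mult_eq_1')
  then have "d - p = d * (1 - ?q)"
    by (simp add: right_diff_distrib mult.left_commute[of d p])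
  then have "inverse (d - p) = inverse d * inverse (1 - ?q)"
    by (simp add: fps_inverse_mult)
  moreover have "fps_nth (inverse (1 - ?q)) i \<ge> 0" for i
    using assms by (intro fps_nth_inverse_one_minus_nonneg fps_nth_mult_nonneg) simp_all
  ultimately show ?thesis
    using assms(2) by (simp add: fps_nth_mult_nonneg)
qed

theorem corollary5p2:
  fixes A B :: "nat set" and m :: nat
  assumes "A \<subseteq> {n. odd n}"
    and "B \<subseteq> {n. even n \<and> n \<ge> 2}"
    and "1 \<in> A"
    and "m \<ge> 1"
    and "2 * m \<in> {1..} - (A \<union> B)"
    and "\<forall>n \<in> {1..} - (A \<union> B). 2 * m \<le> n"
    and "\<forall>n. fps_nth (1 / (1 + (\<Sum>k=1..2*m-1. fps_const ((-1) ^ k / fact k) * fps_X ^ k)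
                              + exp_gf {2 * k | k. k \<ge> m + 1})) n \<ge> 0"
  shows "\<forall>n. fps_nth (1 / (1 - exp_gf A + exp_gf B)) n \<ge> 0"
proof -
  define d :: "real fps" where
    "d = 1 + (\<Sum>k=1..2*m-1. fps_const ((-1) ^ k / fact k) * fps_X ^ k)
           + exp_gf {2 * k | k. k \<ge> m + 1}"
  define e :: "real fps" where "e = 1 - exp_gf A + exp_gf B"
  have d_nth: "fps_nth d n = (if n = 0 then 1 else if n < 2 * m then (-1) ^ n / fact n
      else if even n \<and> n > 2 * m then 1 / fact n else 0)" for n
  proof -
    have "fps_nth (\<Sum>k=1..2*m-1. fps_const ((-1) ^ k / fact k :: real) * fps_X ^ k) n
        = (if n \<in> {1..2*m-1} then (-1) ^ n / fact n else 0)"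
      by (simp add: fps_sum_nth if_distrib cong: if_cong)
    moreover have "n \<in> {2 * k | k. k \<ge> m + 1} \<longleftrightarrow> even n \<and> n > 2 * m"
      by auto
    ultimately show ?thesis
      by (auto simp: d_def exp_gf_def)
  qed
  \<comment> \<open>Testing \<open>A\<close> before \<open>B\<close> is harmless: parity makes them
    disjoint, and neither contains 0.\<close>
  have e_nth: "fps_nth e n = (if n = 0 then 1 else if n \<in> A then - 1 / fact n
      else if n \<in> B then 1 / fact n else 0)" for n
    using assms(1,2) by (auto simp: e_def exp_gf_def)
  have below: "n \<in> A \<longleftrightarrow> odd n" "n \<in> B \<longleftrightarrow> even n" if "0 < n" "n < 2 * m" for n
  proof -
    have "n \<in> A \<union> B"
    proof (rule ccontr)
      assume "n \<notin> A \<union> B"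
      with \<open>0 < n\<close> assms(6) have "2 * m \<le> n" by simp
      with \<open>n < 2 * m\<close> show False by simp
    qed
    with assms(1,2) show "n \<in> A \<longleftrightarrow> odd n" "n \<in> B \<longleftrightarrow> even n" by auto
  qed
  \<comment> \<open>Below \<open>2 * m\<close> the coefficients agree. At \<open>2 * m\<close> both
    are 0, since \<open>d\<close> skips this exponent and \<open>A \<union> B\<close> omits it.
    Above, \<open>d\<close> has 0 at odd \<open>n\<close>, where \<open>e\<close> has 0 or
    \<open>- 1 / fact n\<close>, and \<open>1 / fact n\<close> at even \<open>n\<close>, the most
    that \<open>e\<close> can have.\<close>
  have le: "fps_nth e n \<le> fps_nth d n" for n
    using assms(1,2,5) below[of n] by (cases "n < 2 * m") (auto simp: d_nth e_nth)
  have "fps_nth (inverse d) n \<ge> 0" for n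
    using assms(7)[folded d_def] by (simp add: fps_divide_unit d_nth)
  \<comment> \<open>The subtracted series is \<open>d - e\<close>: non-negative by
    \<open>le\<close>, and without constant term because \<open>d\<close> and \<open>e\<close> both
    start with 1.\<close>
  then have "fps_nth (inverse (d - (d - e))) n \<ge> 0" for n
    using le by (intro fps_nth_inverse_diff_nonneg) (simp_all add: d_nth e_nth)
  then show ?thesis
    unfolding e_def[symmetric] by (simp add: fps_divide_unit e_nth)
qed

end
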